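(* Let $G$ and $H$ be two non-trivial connected graphs of order $m$ and $n$, respectively. Then $$\max\{\gamma(G),\gamma(H)\}\leq \widetilde{\gamma}_{wcon}(G\boxtimes H)\leq \min\{\widetilde{\gamma}_{wcon}(G)\,n,\ \widetilde{\gamma}_{wcon}(H)\,m\}.$$
   Context: All graphs are simple and undirected; a graph is non-trivial if it has at least two vertices, and its order is its number of vertices. A set $C\subseteq V(G)$ is a dominating set of $G$ if every vertex of $V(G)\setminus C$ is adjacent in $G$ to some vertex of $C$; the domination number $\gamma(G)$ is the minimum cardinality of a dominating set of $G$. For a connected graph $G$, an $x$–$y$ geodesic is a shortest $x$–$y$ path in $G$. A set $C\subseteq V(G)$ is weakly convex if for every $x,y\in C$ there is an $x$–$y$ geodesic of $G$ all of whose vertices are in $C$ (so the empty set is vacuously weakly convex). A set $D\subseteq V(G)$ is an outer-weakly convex dominating set of $G$ if it is a dominating set of $G$ and $V(G)\setminus D$ is weakly convex in $G$. The outer-weakly convex domination number $\widetilde{\gamma}_{wcon}(G)$ is the minimum cardinality of an outer-weakly convex dominating set of $G$. The strong product $G\boxtimes H$ has vertex set $V(G)\times V(H)$, with $(g,h)$ and $(g',h')$ adjacent if and only if one of the following holds: $gg'\in E(G)$ and $h=h'$; or $g=g'$ and $hh'\in E(H)$; or $gg'\in E(G)$ and $hh'\in E(H)$. *)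

theory Defs
  imports "Graph_Theory.Digraph_Component" "Graph_Theory.Vertex_Walk"
begin

text \<open>
  A finite simple undirected graph is a \<^locale>\<open>pair_graph\<close>: a finite loopfree symmetric digraph
  whose arcs are pairs of vertices, so that an edge is a pair of opposite arcs. The notions below
  only depend on the vertices and on the adjacency relation, and are stated for
  \<^typ>\<open>('a, 'b) pre_digraph\<close>; they apply to pair graphs through the coercion \<^const>\<open>with_proj\<close>.
\<close>

definition dominating_set :: "('a, 'b) pre_digraph \<Rightarrow> 'a set \<Rightarrow> bool" where
  "dominating_set G C \<longleftrightarrow>
     C \<subseteq> verts G \<and> (\<forall>v \<in> verts G - C. \<exists>c \<in> C. v \<rightarrow>\<^bsub>G\<^esub> c)"

definition domination_number :: "('a, 'b) pre_digraph \<Rightarrow> nat" where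
  "domination_number G = (LEAST k. \<exists>C. dominating_set G C \<and> card C = k)"

text \<open>
  Paths are given by their vertex lists; the one-vertex list is the path of length 0 from a vertex
  to itself.
\<close>

definition geodesic :: "('a, 'b) pre_digraph \<Rightarrow> 'a \<Rightarrow> 'a vwalk \<Rightarrow> 'a \<Rightarrow> bool" where
  "geodesic G x p y \<longleftrightarrow>
     vpath p G \<and> hd p = x \<and> last p = y \<and>
     (\<forall>q. vpath q G \<and> hd q = x \<and> last q = y \<longrightarrow> vwalk_length p \<le> vwalk_length q)"

definition weakly_convex :: "('a, 'b) pre_digraph \<Rightarrow> 'a set \<Rightarrow> bool" where
  "weakly_convex G C \<longleftrightarrow>
     C \<subseteq> verts G \<and> (\<forall>x \<in> C. \<forall>y \<in> C. \<exists>p. geodesic G x p y \<and> set p \<subseteq> C)"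

definition outer_weakly_convex_dominating_set :: "('a, 'b) pre_digraph \<Rightarrow> 'a set \<Rightarrow> bool" where
  "outer_weakly_convex_dominating_set G D \<longleftrightarrow>
     dominating_set G D \<and> weakly_convex G (verts G - D)"

definition outer_weakly_convex_domination_number :: "('a, 'b) pre_digraph \<Rightarrow> nat" where
  "outer_weakly_convex_domination_number G =
     (LEAST k. \<exists>D. outer_weakly_convex_dominating_set G D \<and> card D = k)"

definition strong_product ::
    "'a pair_pre_digraph \<Rightarrow> 'b pair_pre_digraph \<Rightarrow> ('a \<times> 'b) pair_pre_digraph"
    (infixl \<open>\<boxtimes>\<close> 70) where
  "G \<boxtimes> H =
     \<lparr> pverts = pverts G \<times> pverts H,
       parcs = {((g, h), (g', h')) | g h g' h'.
         (g, g') \<in> parcs G \<and> h = h' \<and> h \<in> pverts H \<or>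
         g = g' \<and> g \<in> pverts G \<and> (h, h') \<in> parcs H \<or>
         (g, g') \<in> parcs G \<and> (h, h') \<in> parcs H} \<rparr>"

lemma pair_graph_strong_product:
  assumes "pair_graph G" and "pair_graph H"
  shows "pair_graph (G \<boxtimes> H)"
proof -
  interpret G: pair_graph G by fact
  interpret H: pair_graph H by fact
  have wf: "parcs (G \<boxtimes> H) \<subseteq> pverts (G \<boxtimes> H) \<times> pverts (G \<boxtimes> H)"
    by (auto simp: strong_product_def dest: G.wellformed' H.wellformed')
  have fin: "finite (pverts (G \<boxtimes> H))"
    by (simp add: strong_product_def G.pair_finite_verts H.pair_finite_verts)
  show ?thesis
  proof unfold_locales
    show "finite (parcs (G \<boxtimes> H))"
      using finite_subset[OF wf] fin by blast
    show "symmetric (with_proj (G \<boxtimes> H))"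
      unfolding symmetric_def
      by (auto simp: strong_product_def intro!: symI dest: G.arcs_symmetric H.arcs_symmetric)
    show "fst e \<noteq> snd e" if "e \<in> parcs (G \<boxtimes> H)" for e
      using that by (auto simp: strong_product_def dest: G.no_loops' H.no_loops')
  qed (use wf fin in auto)
qed

end

theory Submission
  imports Defs
begin

text \<open>Lower bound: an edge of the strong product projects to an edge or to a single vertex of
  each factor, so both projections of a dominating set are dominating
  (\<open>dominating_set_fst\<close>, \<open>dominating_set_snd\<close>), and projecting does not
  increase cardinality. Upper bound: a set D that is good for G yields D \<times> V(H). Its
  complement is (V(G) - D) \<times> V(H), and products of weakly convex sets are weakly convex
  (\<open>weakly_convex_strong_product\<close>), because geodesics of the factors combine into one
  of the product (\<open>geodesic_strong_product\<close>). Connectedness makes V(H) itself weakly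
  convex. The roles of G and H can be exchanged.\<close>

section \<open>Walks, paths and geodesics\<close>

lemma vwalk_iff_successively:
  "vwalk p G \<longleftrightarrow> p \<noteq> [] \<and> set p \<subseteq> verts G \<and> successively (\<lambda>u v. (u, v) \<in> arcs_ends G) p"
proof -
  have "set (vwalk_arcs p) \<subseteq> A \<longleftrightarrow> successively (\<lambda>u v. (u, v) \<in> A) p" for A
    by (induction p rule: vwalk_arcs.induct) auto
  then show ?thesis
    by (auto simp: vwalk_def)
qed

lemma vwalk_to_vpath_length_le: "length (vwalk_to_vpath p) \<le> length p"
proof (induction p rule: vwalk_to_vpath_induct3)
  case (in_set x xs)
  then show ?case
    using length_dropWhile_le[of "\<lambda>y. y \<noteq> x" xs] by simp
qed auto

text \<open>A map that may collapse arcs still sends a walk to a walk once consecutive repetitions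
  are merged, and cutting out cycles then gives a path; neither operation adds vertices. For the
  projections of a product this bounds distances in the factors by those in the product.\<close>

lemma vpath_image:
  assumes "vwalk r P"
    and "f ` verts P \<subseteq> verts G"
    and "\<And>u v. (u, v) \<in> arcs_ends P \<Longrightarrow> f u = f v \<or> (f u, f v) \<in> arcs_ends G"
  obtains p where "vpath p G" "hd p = f (hd r)" "last p = f (last r)" "length p \<le> length r"
proof
  let ?p = "remdups_adj (map f r)"
  have r: "r \<noteq> []" "set r \<subseteq> verts P" "successively (\<lambda>u v. (u, v) \<in> arcs_ends P) r"
    using assms(1) by (auto simp: vwalk_iff_successively)
  have "successively (\<lambda>u v. u = v \<or> (u, v) \<in> arcs_ends G) (map f r)"
    unfolding successively_map by (rule successively_mono[OF r(3)]) (use assms(3) in auto)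
  then have "successively (\<lambda>u v. u = v \<or> (u, v) \<in> arcs_ends G) ?p"
    by (subst successively_remdups_adj_iff) auto
  \<comment> \<open>Neighbouring entries of \<open>remdups_adj\<close> differ, which rules out the
    alternative u = v.\<close>
  then have "successively (\<lambda>u v. (u, v) \<in> arcs_ends G) ?p"
    unfolding successively_conv_nth using remdups_adj_adjacent by blast
  then have "vwalk ?p G"
    using r(1,2) assms(2) by (auto simp: vwalk_iff_successively)
  then show "vpath (vwalk_to_vpath ?p) G"
    by (rule vwalk_to_vpath_vpath)
  show "hd (vwalk_to_vpath ?p) = f (hd r)"
    using r(1) by (simp add: vwalk_to_vpath_hd hd_map)
  show "last (vwalk_to_vpath ?p) = f (last r)"
    using r(1) by (simp add: vwalk_to_vpath_last last_map)
  show "length (vwalk_to_vpath ?p) \<le> length r"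
    using vwalk_to_vpath_length_le[of ?p] remdups_adj_length[of "map f r"] by simp
qed

lemma (in wf_digraph) reachable_imp_ex_vwalk:
  assumes "u \<rightarrow>\<^sup>*\<^bsub>G\<^esub> v"
  shows "\<exists>p. vwalk p G \<and> hd p = u \<and> last p = v"
  using assms
proof (induction rule: converse_reachable_induct)
  case base
  then show ?case
    by (intro exI[of _ "[v]"]) auto
next
  case (step x y)
  then obtain p where "vwalk p G" "hd p = y" "last p = v"
    by blast
  then show ?case
    using step.hyps by (intro exI[of _ "x # p"]) (auto intro: vwalk_wf_digraph_consI)
qed

text \<open>Any two vertices are joined by a walk, hence by a path, and among these paths one of
  least length is a geodesic.\<close>

lemma (in wf_digraph) weakly_convex_verts:
  assumes "strongly_connected G"
  shows "weakly_convex G (verts G)"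
  unfolding weakly_convex_def
proof (intro conjI ballI subset_refl)
  fix x y
  assume "x \<in> verts G" "y \<in> verts G"
  then have "x \<rightarrow>\<^sup>*\<^bsub>G\<^esub> y"
    using assms by auto
  then obtain p where p: "vpath p G \<and> hd p = x \<and> last p = y"
    using reachable_imp_ex_vwalk vwalk_imp_ex_vpath by metis
  show "\<exists>p. geodesic G x p y \<and> set p \<subseteq> verts G"
    using ex_has_least_nat[of "\<lambda>p. vpath p G \<and> hd p = x \<and> last p = y", OF p, of vwalk_length]
    unfolding geodesic_def vpath_def vwalk_def by blast
qed

section \<open>Geodesics and weak convexity in the strong product\<close>

lemma arcs_strong_product_iff:
  "((g, h), (g', h')) \<in> parcs (G \<boxtimes> H) \<longleftrightarrow>
     (g, g') \<in> parcs G \<and> h = h' \<and> h \<in> pverts H \<or>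
     g = g' \<and> g \<in> pverts G \<and> (h, h') \<in> parcs H \<or>
     (g, g') \<in> parcs G \<and> (h, h') \<in> parcs H"
  by (auto simp: strong_product_def)

lemma verts_strong_product [simp]: "pverts (G \<boxtimes> H) = pverts G \<times> pverts H"
  by (simp add: strong_product_def)

text \<open>Distances in the strong product are the maxima of the distances in the factors: two
  geodesics are traversed simultaneously, waiting at the end of the shorter one.\<close>

lemma geodesic_strong_product:
  assumes "geodesic (with_proj G) x p x'" "geodesic (with_proj H) y q y'"
  shows "\<exists>r. geodesic (with_proj (G \<boxtimes> H)) (x, y) r (x', y') \<and> set r \<subseteq> set p \<times> set q"
proof -
  have p: "p \<noteq> []" "set p \<subseteq> pverts G" "distinct p" "hd p = x" "last p = x'"
    "\<And>i. Suc i < length p \<Longrightarrow> (p ! i, p ! Suc i) \<in> parcs G"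
    using assms(1) by (auto simp: geodesic_def vpath_def vwalk_iff_successively successively_conv_nth)
  have q: "q \<noteq> []" "set q \<subseteq> pverts H" "distinct q" "hd q = y" "last q = y'"
    "\<And>i. Suc i < length q \<Longrightarrow> (q ! i, q ! Suc i) \<in> parcs H"
    using assms(2) by (auto simp: geodesic_def vpath_def vwalk_iff_successively successively_conv_nth)
  \<comment> \<open>Clamping the index at the last position of each path makes the shorter one wait
    at its end.\<close>
  define n where "n = max (length p) (length q)"
  define s where "s = (\<lambda>i. (p ! min i (length p - 1), q ! min i (length q - 1)))"
  define r where "r = map s [0..<n]"
  have len: "length r = n" and nth: "\<And>i. i < n \<Longrightarrow> r ! i = s i"
    by (simp_all add: r_def)
  have n: "n > 0"
    using p(1) by (simp add: n_def less_max_iff_disj)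
  then have "r \<noteq> []"
    by (simp add: r_def)
  have "hd r = (x, y)"
    using p(1,4) q(1,4) n \<open>r \<noteq> []\<close> by (simp add: hd_conv_nth nth s_def)
  have "last r = (x', y')"
  proof -
    have "min (n - 1) (length p - 1) = length p - 1" "min (n - 1) (length q - 1) = length q - 1"
      by (auto simp: n_def)
    then show ?thesis
      using p(1,5) q(1,5) n \<open>r \<noteq> []\<close> by (simp add: last_conv_nth len nth s_def)
  qed
  have bound: "min i (length p - 1) < length p" "min i (length q - 1) < length q" for i
    using p(1) q(1) by (simp_all add: min_less_iff_disj)
  then have sub: "set r \<subseteq> set p \<times> set q"
    by (auto simp: r_def s_def simp del: One_nat_def)
  \<comment> \<open>The longer path never waits at indices below n, so its distinctness already
    separates the pairs.\<close>
  have inj: "inj_on s {..<n}"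
  proof (cases "length p \<le> length q")
    case True
    then show ?thesis
      using q(3) by (auto simp: inj_on_def s_def n_def nth_eq_iff_index_eq)
  next
    case False
    then show ?thesis
      using p(3) by (auto simp: inj_on_def s_def n_def nth_eq_iff_index_eq)
  qed
  then have "distinct r"
    by (simp add: r_def distinct_map atLeast0LessThan)
  have "(r ! i, r ! Suc i) \<in> parcs (G \<boxtimes> H)" if i: "Suc i < n" for i
  proof -
    have mem: "p ! min i (length p - 1) \<in> pverts G" "q ! min i (length q - 1) \<in> pverts H"
      using p(2) q(2) nth_mem[OF bound(1)] nth_mem[OF bound(2)] by blast+
    have stay: "min i (k - 1) = min (Suc i) (k - 1)" if "\<not> Suc i < k" for k
      using that by auto
    have step: "min i (k - 1) = i" "min (Suc i) (k - 1) = Suc i" if "Suc i < k" for k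
      using that by auto
    \<comment> \<open>At least one coordinate advances; which of them do so selects the clause of
      the strong product that gives the arc.\<close>
    have "Suc i < length p \<or> Suc i < length q"
      using i unfolding n_def less_max_iff_disj .
    then show ?thesis
      using mem p(6)[of i] q(6)[of i] i
      by (cases "Suc i < length p"; cases "Suc i < length q")
        (simp_all add: nth s_def arcs_strong_product_iff stay step del: One_nat_def)
  qed
  then have "vpath r (with_proj (G \<boxtimes> H))"
    using \<open>r \<noteq> []\<close> \<open>distinct r\<close> sub p(2) q(2)
    by (auto simp: vpath_def vwalk_iff_successively successively_conv_nth len)
  \<comment> \<open>Minimality: both projections of a competitor t shorten to paths between the ends
    of p and of q, so t is at least as long as the longer geodesic.\<close>
  moreover have "length r \<le> length t"
    if t: "vpath t (with_proj (G \<boxtimes> H))" "hd t = (x, y)" "last t = (x', y')" for t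
  proof -
    have w: "vwalk t (with_proj (G \<boxtimes> H))"
      using t(1) by auto
    obtain t1 where t1: "vpath t1 (with_proj G)" "hd t1 = x" "last t1 = x'" "length t1 \<le> length t"
      by (rule vpath_image[OF w, of fst "with_proj G"]) (use t in \<open>auto simp: arcs_strong_product_iff\<close>)
    obtain t2 where t2: "vpath t2 (with_proj H)" "hd t2 = y" "last t2 = y'" "length t2 \<le> length t"
      by (rule vpath_image[OF w, of snd "with_proj H"]) (use t in \<open>auto simp: arcs_strong_product_iff\<close>)
    \<comment> \<open>Geodesics compare numbers of arcs, \<open>length - 1\<close> with truncated
      subtraction; nonemptiness allows the return to \<open>length\<close>.\<close>
    have "t1 \<noteq> []" "t2 \<noteq> []"
      using t1(1) t2(1) by auto
    moreover have "length p - 1 \<le> length t1 - 1" "length q - 1 \<le> length t2 - 1"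
      using assms t1 t2 by (auto simp: geodesic_def)
    ultimately show ?thesis
      using t1(4) t2(4) by (cases t1; cases t2) (auto simp: len n_def)
  qed
  ultimately have "geodesic (with_proj (G \<boxtimes> H)) (x, y) r (x', y')"
    using \<open>hd r = (x, y)\<close> \<open>last r = (x', y')\<close> by (auto simp: geodesic_def intro: diff_le_mono)
  with sub show ?thesis
    by blast
qed

lemma weakly_convex_strong_product:
  assumes "weakly_convex (with_proj G) A" "weakly_convex (with_proj H) B"
  shows "weakly_convex (with_proj (G \<boxtimes> H)) (A \<times> B)"
  unfolding weakly_convex_def
proof (intro conjI ballI)
  show "A \<times> B \<subseteq> verts (with_proj (G \<boxtimes> H))"
    using assms by (auto simp: weakly_convex_def)
next
  fix u v
  assume "u \<in> A \<times> B" "v \<in> A \<times> B"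
  then obtain x y x' y' where uv: "u = (x, y)" "v = (x', y')" "x \<in> A" "y \<in> B" "x' \<in> A" "y' \<in> B"
    by auto
  obtain p q where "geodesic (with_proj G) x p x'" "set p \<subseteq> A"
      "geodesic (with_proj H) y q y'" "set q \<subseteq> B"
    using assms uv unfolding weakly_convex_def by metis
  then show "\<exists>r. geodesic (with_proj (G \<boxtimes> H)) u r v \<and> set r \<subseteq> A \<times> B"
    using geodesic_strong_product[of G x p x' H y q y'] uv by (meson Sigma_mono subset_trans)
qed

section \<open>Lifting and projecting dominating sets\<close>

text \<open>A vertex (g, h) outside is dominated by (c, h), where c in D dominates g, and the
  complement is again a product of weakly convex sets.\<close>

lemma outer_weakly_convex_dominating_set_times_verts:
  assumes "outer_weakly_convex_dominating_set (with_proj G) D"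
    and "weakly_convex (with_proj H) (pverts H)"
  shows "outer_weakly_convex_dominating_set (with_proj (G \<boxtimes> H)) (D \<times> pverts H)"
proof -
  have "pverts G \<times> pverts H - D \<times> pverts H = (pverts G - D) \<times> pverts H"
    by auto
  then show ?thesis
    using assms weakly_convex_strong_product[of G "pverts G - D" H "pverts H"]
    by (fastforce simp: outer_weakly_convex_dominating_set_def dominating_set_def
        arcs_strong_product_iff)
qed

lemma outer_weakly_convex_dominating_set_verts_times:
  assumes "outer_weakly_convex_dominating_set (with_proj H) D"
    and "weakly_convex (with_proj G) (pverts G)"
  shows "outer_weakly_convex_dominating_set (with_proj (G \<boxtimes> H)) (pverts G \<times> D)"
proof -
  have "pverts G \<times> pverts H - pverts G \<times> D = pverts G \<times> (pverts H - D)"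
    by auto
  then show ?thesis
    using assms weakly_convex_strong_product[of G "pverts G" H "pverts H - D"]
    by (fastforce simp: outer_weakly_convex_dominating_set_def dominating_set_def
        arcs_strong_product_iff)
qed

text \<open>If g lies outside the projection, the whole fibre over g avoids D, so any vertex (g, h)
  of it has a neighbour in D.\<close>

lemma dominating_set_fst:
  assumes "dominating_set (with_proj (G \<boxtimes> H)) D" "pverts H \<noteq> {}"
  shows "dominating_set (with_proj G) (fst ` D)"
  unfolding dominating_set_def
proof (intro conjI ballI)
  show "fst ` D \<subseteq> verts (with_proj G)"
    using assms(1) by (auto simp: dominating_set_def)
next
  fix g
  assume g: "g \<in> verts (with_proj G) - fst ` D"
  obtain h where "h \<in> pverts H"
    using assms(2) by blast
  then have "(g, h) \<in> pverts G \<times> pverts H - D"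
    using g by force
  then obtain g' h' where "(g', h') \<in> D" "((g, h), (g', h')) \<in> parcs (G \<boxtimes> H)"
    using assms(1) by (fastforce simp: dominating_set_def)
  \<comment> \<open>Here g' lies in the projection and g does not, so g \<noteq> g' and the arc of
    the product projects to an arc of G.\<close>
  then show "\<exists>c\<in>fst ` D. g \<rightarrow>\<^bsub>with_proj G\<^esub> c"
    using g by (force simp: arcs_strong_product_iff)
qed

lemma dominating_set_snd:
  assumes "dominating_set (with_proj (G \<boxtimes> H)) D" "pverts G \<noteq> {}"
  shows "dominating_set (with_proj H) (snd ` D)"
  unfolding dominating_set_def
proof (intro conjI ballI)
  show "snd ` D \<subseteq> verts (with_proj H)"
    using assms(1) by (auto simp: dominating_set_def)
next
  fix h
  assume h: "h \<in> verts (with_proj H) - snd ` D"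
  obtain g where "g \<in> pverts G"
    using assms(2) by blast
  then have "(g, h) \<in> pverts G \<times> pverts H - D"
    using h by force
  then obtain g' h' where "(g', h') \<in> D" "((g, h), (g', h')) \<in> parcs (G \<boxtimes> H)"
    using assms(1) by (fastforce simp: dominating_set_def)
  then show "\<exists>c\<in>snd ` D. h \<rightarrow>\<^bsub>with_proj H\<^esub> c"
    using h by (force simp: arcs_strong_product_iff)
qed

section \<open>Minimum sets and the two bounds\<close>

lemma domination_number_le: "dominating_set G C \<Longrightarrow> domination_number G \<le> card C"
  unfolding domination_number_def by (auto intro: Least_le)

lemma outer_weakly_convex_domination_number_le:
  "outer_weakly_convex_dominating_set G D \<Longrightarrow> outer_weakly_convex_domination_number G \<le> card D"
  unfolding outer_weakly_convex_domination_number_def by (auto intro: Least_le)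

text \<open>The complement is empty and so vacuously weakly convex. This witness ensures that the
  \<open>LEAST\<close> in the definition is attained.\<close>

lemma outer_weakly_convex_dominating_set_verts:
  "outer_weakly_convex_dominating_set G (verts G)"
  by (simp add: outer_weakly_convex_dominating_set_def dominating_set_def weakly_convex_def)

lemma minimum_outer_weakly_convex_dominating_set:
  obtains D where "outer_weakly_convex_dominating_set G D"
    "card D = outer_weakly_convex_domination_number G"
proof -
  let ?P = "\<lambda>k. \<exists>D. outer_weakly_convex_dominating_set G D \<and> card D = k"
  have "?P (card (verts G))"
    using outer_weakly_convex_dominating_set_verts by blast
  then have "?P (LEAST k. ?P k)"
    by (rule LeastI)
  with that show thesis
    unfolding outer_weakly_convex_domination_number_def by blast
qed

lemma weakly_convex_pverts:
  assumes "pair_graph G" "Digraph_Component.connected (with_proj G)"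
  shows "weakly_convex (with_proj G) (pverts G)"
proof -
  interpret pair_graph G
    by fact
  show ?thesis
    using weakly_convex_verts symmetric_connected_imp_strongly_connected[OF sym_arcs assms(2)]
    by simp
qed

theorem theorem3:
  fixes G :: "'a pair_pre_digraph" and H :: "'b pair_pre_digraph" and m n :: nat
  assumes "pair_graph G" and "pair_graph H"
    and "Digraph_Component.connected (with_proj G)"
    and "Digraph_Component.connected (with_proj H)"
    and "m = card (pverts G)" and "n = card (pverts H)"
    and "m \<ge> 2" and "n \<ge> 2"
  shows "max (domination_number (with_proj G)) (domination_number (with_proj H))
       \<le> outer_weakly_convex_domination_number (with_proj (G \<boxtimes> H))
     \<and> outer_weakly_convex_domination_number (with_proj (G \<boxtimes> H))
       \<le> min (outer_weakly_convex_domination_number (with_proj G) * n)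
             (outer_weakly_convex_domination_number (with_proj H) * m)"
proof -
  have nonempty: "pverts G \<noteq> {}" "pverts H \<noteq> {}"
    using assms(5-8) by auto
  \<comment> \<open>Infinite sets have \<open>card\<close> 0, so m, n \<ge> 2 forces both vertex
    sets to be finite.\<close>
  have finite: "finite (pverts G \<times> pverts H)"
    using assms(5-8) by (intro finite_cartesian_product card_ge_0_finite) auto
  note convex = weakly_convex_pverts[OF assms(1,3)] weakly_convex_pverts[OF assms(2,4)]
  obtain D where D: "outer_weakly_convex_dominating_set (with_proj (G \<boxtimes> H)) D"
      "card D = outer_weakly_convex_domination_number (with_proj (G \<boxtimes> H))"
    by (rule minimum_outer_weakly_convex_dominating_set)
  then have dom: "dominating_set (with_proj (G \<boxtimes> H)) D"
    by (simp add: outer_weakly_convex_dominating_set_def)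
  then have "finite D"
    using finite by (auto simp: dominating_set_def intro: finite_subset)
  then have "card (fst ` D) \<le> card D" "card (snd ` D) \<le> card D"
    by (simp_all add: card_image_le)
  then have lower: "max (domination_number (with_proj G)) (domination_number (with_proj H)) \<le> card D"
    using domination_number_le[OF dominating_set_fst[OF dom nonempty(2)]]
      domination_number_le[OF dominating_set_snd[OF dom nonempty(1)]] by simp
  obtain A where A: "outer_weakly_convex_dominating_set (with_proj G) A"
      "card A = outer_weakly_convex_domination_number (with_proj G)"
    by (rule minimum_outer_weakly_convex_dominating_set)
  obtain B where B: "outer_weakly_convex_dominating_set (with_proj H) B"
      "card B = outer_weakly_convex_domination_number (with_proj H)"
    by (rule minimum_outer_weakly_convex_dominating_set)
  \<comment> \<open>The lifts of the minimum sets A and B have cardinalities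
    \<open>card A * n\<close> and \<open>m * card B\<close>.\<close>
  show ?thesis
    using lower D(2) A(2) B(2) assms(5,6)
      outer_weakly_convex_domination_number_le
        [OF outer_weakly_convex_dominating_set_times_verts[OF A(1) convex(2)]]
      outer_weakly_convex_domination_number_le
        [OF outer_weakly_convex_dominating_set_verts_times[OF B(1) convex(1)]]
    by (simp add: card_cartesian_product mult.commute)
qed

end
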